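(* The substitution dynamical system $X\subset\Sigma^{\mathbb Z}$ of a primitive substitution over a finite alphabet $\Sigma$ is $\lambda$-synchronizing.
   Context: A substitution over $\Sigma$ is a map $\tau$ from $\Sigma$ to the nonempty finite words over $\Sigma$, extended to words by concatenation. It is primitive if there is $n\in\mathbb N$ such that for all $\alpha,\beta\in\Sigma$ the symbol $\beta$ occurs in $\tau^n(\alpha)$. Its substitution dynamical system is the subshift $X$ of all $x\in\Sigma^{\mathbb Z}$ such that every finite subword of $x$ occurs as a subword of $\tau^n(\alpha)$ for some $n\in\mathbb N$, $\alpha\in\Sigma$. For a subshift $X$, $\mathcal L(X)$ is the set of (nonempty) finite words appearing in points of $X$, $\mathcal L_n(X)$ those of length $n$. $\Gamma^+(a)=\{c\in\mathcal L(X): ac\in\mathcal L(X)\}$, $\Gamma^-_l(a)=\{c\in\mathcal L_l(X): ca\in\mathcal L(X)\}$, $\omega^-_l(a)=\bigcap_{c\in\Gamma^+(a)}\{b\in\mathcal L_l(X): bac\in\mathcal L(X)\}$. A word $v\in\mathcal L(X)$ is $l$-synchronizing if $\Gamma^-_l(v)\subset\omega^-_l(v)$; $\mathcal S_l(X)$ is the set of these words. $X$ is $\lambda$-synchronizing if for all $w\in\mathcal L(X)$, $k\in\mathbb N$ there is $v\in\mathcal S_k(X)\cap\Gamma^+(w)$. *)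

theory Defs
  imports Main "HOL-Library.Sublist"
begin

text \<open>
  The alphabet is a finite type, words are lists and points of the full shift are functions
  on the integers.  A natural number index may be \<open>0\<close> throughout.  Nothing depends on this:
  the words of the language are nonempty, so there are none of length \<open>0\<close>, every word of the
  language is \<open>0\<close>-synchronizing, and the zeroth iterate of a substitution adds nothing to
  primitivity or to the dynamical system of a primitive substitution.
\<close>

definition is_substitution :: "('a \<Rightarrow> 'a list) \<Rightarrow> bool" where
  "is_substitution \<tau> \<longleftrightarrow> (\<forall>\<alpha>. \<tau> \<alpha> \<noteq> [])"

definition subst_word :: "('a \<Rightarrow> 'a list) \<Rightarrow> 'a list \<Rightarrow> 'a list" where
  "subst_word \<tau> w = concat (map \<tau> w)"

definition primitive_subst :: "('a \<Rightarrow> 'a list) \<Rightarrow> bool" where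
  "primitive_subst \<tau> \<longleftrightarrow> (\<exists>n::nat. \<forall>\<alpha> \<beta>. \<beta> \<in> set ((subst_word \<tau> ^^ n) [\<alpha>]))"

definition occurs_in :: "'a list \<Rightarrow> (int \<Rightarrow> 'a) \<Rightarrow> bool" where
  "occurs_in w x \<longleftrightarrow> (\<exists>i. w = map (\<lambda>j. x (i + int j)) [0..<length w])"

definition substitution_system :: "('a \<Rightarrow> 'a list) \<Rightarrow> (int \<Rightarrow> 'a) set" where
  "substitution_system \<tau> =
     {x. \<forall>w. occurs_in w x \<longrightarrow> (\<exists>n::nat. \<exists>\<alpha>. sublist w ((subst_word \<tau> ^^ n) [\<alpha>]))}"

definition language :: "(int \<Rightarrow> 'a) set \<Rightarrow> 'a list set" where
  "language X = {w. w \<noteq> [] \<and> (\<exists>x\<in>X. occurs_in w x)}"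

definition language_n :: "(int \<Rightarrow> 'a) set \<Rightarrow> nat \<Rightarrow> 'a list set" where
  "language_n X n = {w \<in> language X. length w = n}"

definition Gamma_plus :: "(int \<Rightarrow> 'a) set \<Rightarrow> 'a list \<Rightarrow> 'a list set" where
  "Gamma_plus X a = {c \<in> language X. a @ c \<in> language X}"

definition Gamma_minus :: "(int \<Rightarrow> 'a) set \<Rightarrow> nat \<Rightarrow> 'a list \<Rightarrow> 'a list set" where
  "Gamma_minus X l a = {c \<in> language_n X l. c @ a \<in> language X}"

definition omega_minus :: "(int \<Rightarrow> 'a) set \<Rightarrow> nat \<Rightarrow> 'a list \<Rightarrow> 'a list set" where
  "omega_minus X l a = (\<Inter>c\<in>Gamma_plus X a. {b \<in> language_n X l. b @ a @ c \<in> language X})"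

definition synchronizing_words :: "(int \<Rightarrow> 'a) set \<Rightarrow> nat \<Rightarrow> 'a list set" where
  "synchronizing_words X l = {v \<in> language X. Gamma_minus X l v \<subseteq> omega_minus X l v}"

definition lambda_synchronizing :: "(int \<Rightarrow> 'a) set \<Rightarrow> bool" where
  "lambda_synchronizing X \<longleftrightarrow>
     (\<forall>w\<in>language X. \<forall>k::nat. \<exists>v. v \<in> synchronizing_words X k \<inter> Gamma_plus X w)"

end

(*
  Let p be the complexity function of X.  It is at most linear, because a word of length n lies
  in the image of two adjacent letters under an iterate whose blocks have length comparable
  to n.  Suppose that no word in Gamma_plus(w) is k-synchronizing.  Each such word then has two
  different left extensions of length k, so p(n + k) - p(n) is at least the number g(n) of words
  of length n in Gamma_plus(w).  Linear growth of p bounds g(n) for infinitely many n, hence for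
  all n since g is nondecreasing.  By uniform recurrence every word is, up to a prefix of bounded
  length, a word that follows w, so p is bounded as well.  This contradicts
  p(n + k) >= p(n) + g(n) >= p(n) + 1.
*)
theory Submission
  imports Defs
begin

section \<open>Words of a set of bi-infinite sequences\<close>

text \<open>Unlike \<open>occurs_in\<close>, a window keeps its position, so that an occurrence can
  be prolonged to either side inside the same point.\<close>

definition window :: "(int \<Rightarrow> 'a) \<Rightarrow> int \<Rightarrow> nat \<Rightarrow> 'a list" where
  "window x i n = map (\<lambda>j. x (i + int j)) [0..<n]"

lemma length_window [simp]: "length (window x i n) = n"
  by (simp add: window_def)

lemma window_add: "window x i (m + n) = window x i m @ window x (i + int m) n"
  by (auto simp: window_def nth_append algebra_simps intro!: nth_equalityI)

lemma take_window: "m \<le> n \<Longrightarrow> take m (window x i n) = window x i m"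
  by (simp add: window_def take_map)

lemma window_in_language: "x \<in> X \<Longrightarrow> 0 < n \<Longrightarrow> window x i n \<in> language X"
  by (auto simp: language_def occurs_in_def window_def)

lemma languageE:
  assumes "w \<in> language X"
  obtains x i where "x \<in> X" "w = window x i (length w)" "w \<noteq> []"
  using assms by (auto simp: language_def occurs_in_def window_def)

lemma language_appendE:
  assumes "u @ v \<in> language X"
  obtains x i where "x \<in> X" "u = window x i (length u)" "v = window x (i + int (length u)) (length v)"
proof -
  from assms obtain x i where "x \<in> X" "u @ v = window x i (length u + length v)"
    by (elim languageE) auto
  then show thesis
    using that by (auto simp: window_add)
qed

lemma language_append_left:
  assumes "u @ v \<in> language X" "u \<noteq> []"
  shows "u \<in> language X"
  using assms by (elim language_appendE) (metis length_greater_0_conv window_in_language)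

text \<open>Points are bi-infinite, so every occurrence of \<open>v\<close> has \<open>k\<close>
  letters before it.\<close>

lemma language_extend_left:
  assumes "v \<in> language X" "0 < k"
  obtains u where "u \<in> language_n X k" "u @ v \<in> language X"
proof -
  from assms obtain x i where x: "x \<in> X" "v = window x i (length v)"
    by (elim languageE)
  have "window x (i - int k) (k + length v) = window x (i - int k) k @ v"
    using x(2) by (simp add: window_add)
  then show thesis
    using that[of "window x (i - int k) k"] x(1) assms(2)
      window_in_language[of x X "k + length v" "i - int k"]
    by (simp add: language_n_def window_in_language)
qed

lemma finite_language_n [simp]: "finite (language_n (X :: (int \<Rightarrow> 'a::finite) set) n)"
proof (rule finite_subset)
  show "language_n X n \<subseteq> {w. set w \<subseteq> UNIV \<and> length w = n}"
    by (auto simp: language_n_def)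
qed (rule finite_lists_length_eq, simp)

section \<open>Words that follow a given word\<close>

definition follow_n :: "(int \<Rightarrow> 'a) set \<Rightarrow> 'a list \<Rightarrow> nat \<Rightarrow> 'a list set" where
  "follow_n X w n = {v \<in> Gamma_plus X w. length v = n}"

lemma follow_n_subset: "follow_n X w n \<subseteq> language_n X n"
  by (auto simp: follow_n_def Gamma_plus_def language_n_def)

lemma finite_follow_n [simp]: "finite (follow_n (X :: (int \<Rightarrow> 'a::finite) set) w n)"
  using finite_subset[OF follow_n_subset finite_language_n] .

lemma window_in_follow_n:
  assumes "x \<in> X" "w = window x i (length w)" "0 < n"
  shows "window x (i + int (length w)) n \<in> follow_n X w n"
  using assms window_in_language[of x X "length w + n" i]
  by (auto simp: follow_n_def Gamma_plus_def window_in_language window_add)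

lemma follow_n_nonempty:
  assumes "w \<in> language X" "0 < n"
  shows "follow_n X w n \<noteq> {}"
  using assms by (elim languageE) (use window_in_follow_n in blast)

text \<open>Truncation to the first \<open>m\<close> letters maps the longer followers onto the
  shorter ones: a point that contains \<open>w @ v\<close> prolongs \<open>v\<close> to the
  right.\<close>

lemma card_follow_n_mono:
  fixes X :: "(int \<Rightarrow> 'a::finite) set"
  assumes "0 < m" "m \<le> n"
  shows "card (follow_n X w m) \<le> card (follow_n X w n)"
proof (rule surj_card_le)
  show "follow_n X w m \<subseteq> take m ` follow_n X w n"
  proof
    fix v assume "v \<in> follow_n X w m"
    then have v: "w @ v \<in> language X" "length v = m"
      by (auto simp: follow_n_def Gamma_plus_def)
    from v(1) obtain x i where x: "x \<in> X" "w = window x i (length w)"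
      "v = window x (i + int (length w)) (length v)"
      by (elim language_appendE)
    have "v = take m (window x (i + int (length w)) n)"
      using x(3) v(2) assms(2) by (simp add: take_window)
    then show "v \<in> take m ` follow_n X w n"
      using window_in_follow_n[OF x(1,2)] assms by (intro image_eqI) auto
  qed
qed simp

section \<open>Complexity and synchronization\<close>

text \<open>Failure of synchronization gives \<open>u\<close> and \<open>c\<close> such that
  \<open>u @ v\<close> and \<open>v @ c\<close> are in the language but \<open>u @ v @ c\<close> is
  not. Some \<open>u'\<close> does precede \<open>v @ c\<close>, and it must differ from
  \<open>u\<close>.\<close>

lemma not_synchronizing_two_extensions:
  assumes "v \<in> language X" "v \<notin> synchronizing_words X k" "0 < k"
  shows "\<exists>u u'. u \<in> Gamma_minus X k v \<and> u' \<in> Gamma_minus X k v \<and> u \<noteq> u'"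
proof -
  obtain u c where u: "u \<in> Gamma_minus X k v" and c: "v @ c \<in> language X" "u @ v @ c \<notin> language X"
    using assms(1,2)
    by (auto simp: synchronizing_words_def omega_minus_def Gamma_plus_def Gamma_minus_def)
  obtain u' where u': "u' \<in> language_n X k" "u' @ v @ c \<in> language X"
    using language_extend_left[OF c(1) assms(3)] .
  have "v \<noteq> []" using assms(1) by (simp add: language_def)
  then have "u' @ v \<in> language X"
    using u'(2) language_append_left[of "u' @ v" c] by simp
  then have "u' \<in> Gamma_minus X k v"
    using u' by (simp add: Gamma_minus_def)
  then show ?thesis
    using u c(2) u'(2) by blast
qed

text \<open>One left extension \<open>e v\<close> is chosen for every word of length
  \<open>n\<close>, and a second one \<open>e' v\<close> for each word of \<open>G\<close>. The
  resulting words are all distinct, since their last \<open>n\<close> letters recover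
  \<open>v\<close>.\<close>

lemma complexity_increment:
  fixes X :: "(int \<Rightarrow> 'a::finite) set"
  assumes "G \<subseteq> language_n X n" "G \<inter> synchronizing_words X k = {}" "0 < k"
  shows "card (language_n X n) + card G \<le> card (language_n X (n + k))"
proof -
  have "\<exists>u. u \<in> Gamma_minus X k v" if "v \<in> language_n X n" for v
  proof -
    have "v \<in> language X" using that by (simp add: language_n_def)
    from this assms(3) obtain u where "u \<in> language_n X k" "u @ v \<in> language X"
      by (rule language_extend_left)
    then show ?thesis by (auto simp: Gamma_minus_def)
  qed
  then obtain e where e: "\<And>v. v \<in> language_n X n \<Longrightarrow> e v \<in> Gamma_minus X k v"
    using bchoice[of "language_n X n" "\<lambda>v u. u \<in> Gamma_minus X k v"] by blast
  have "\<exists>u. u \<in> Gamma_minus X k v \<and> e v \<noteq> u" if "v \<in> G" for v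
  proof -
    have "v \<in> language X" "v \<notin> synchronizing_words X k"
      using that assms by (auto simp: language_n_def)
    then show ?thesis
      using not_synchronizing_two_extensions[of v X k] assms(3) by metis
  qed
  then obtain e' where e': "\<And>v. v \<in> G \<Longrightarrow> e' v \<in> Gamma_minus X k v \<and> e v \<noteq> e' v"
    using bchoice[of G "\<lambda>v u. u \<in> Gamma_minus X k v \<and> e v \<noteq> u"] by blast
  let ?A = "(\<lambda>v. e v @ v) ` language_n X n" and ?B = "(\<lambda>v. e' v @ v) ` G"
  have len: "length v = n" if "v \<in> language_n X n" for v
    using that by (simp add: language_n_def)
  have A: "card ?A = card (language_n X n)"
    by (intro card_image inj_onI) (simp add: len append_eq_append_conv)
  have B: "card ?B = card G"
    using assms(1) len by (intro card_image inj_onI) (simp add: subset_iff append_eq_append_conv)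
  have disj: "?A \<inter> ?B = {}"
  proof (rule ccontr)
    assume "?A \<inter> ?B \<noteq> {}"
    then obtain v v' where v: "v \<in> language_n X n" "v' \<in> G" "e v @ v = e' v' @ v'"
      by auto
    then have "e v = e' v'" "v = v'"
      using len assms(1) by (auto simp: subset_iff append_eq_append_conv)
    then show False using e' v by blast
  qed
  have fin: "finite G" using finite_subset[OF assms(1)] by simp
  have "?A \<union> ?B \<subseteq> language_n X (n + k)"
  proof (intro Un_least image_subsetI)
    fix v assume "v \<in> language_n X n"
    then show "e v @ v \<in> language_n X (n + k)"
      using e[of v] by (simp add: Gamma_minus_def language_n_def)
  next
    fix v assume "v \<in> G"
    then show "e' v @ v \<in> language_n X (n + k)"
      using e'[of v] assms(1) by (auto simp: Gamma_minus_def language_n_def)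
  qed
  then have "card (?A \<union> ?B) \<le> card (language_n X (n + k))"
    by (intro card_mono) auto
  then show ?thesis
    using card_Un_disjoint[OF _ _ disj] fin A B by simp
qed

text \<open>Used twice: with \<open>d = C * k + 1\<close> against the linear bound on the
  complexity, and with \<open>d = 1\<close> against a constant bound.\<close>

lemma linear_growth_of_increments:
  fixes p :: "nat \<Rightarrow> nat"
  assumes "\<And>n. N \<le> n \<Longrightarrow> p n + d \<le> p (n + k)"
  shows "m * d \<le> p (N + m * k)"
proof (induction m)
  case (Suc m)
  then show ?case using assms[of "N + m * k"] by (simp add: algebra_simps)
qed simp

text \<open>To the right of the starting position of \<open>u\<close>, the word \<open>w\<close>
  soon occurs. The letters up to the end of that occurrence and the \<open>n\<close> letters after
  it determine \<open>u\<close>.\<close>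

lemma complexity_le_follow:
  fixes X :: "(int \<Rightarrow> 'a::finite) set"
  assumes rec: "\<And>u. u \<in> language X \<Longrightarrow> R \<le> length u \<Longrightarrow> sublist w u"
    and "0 < n"
  shows "card (language_n X n) \<le> card {q :: 'a list. length q \<le> R + 1} * card (follow_n X w n)"
proof -
  let ?Q = "{q :: 'a list. length q \<le> R + 1}"
  have fin: "finite ?Q" using finite_lists_length_le[of "UNIV :: 'a set"] by simp
  have "language_n X n \<subseteq> (\<lambda>(q, v). take n (q @ v)) ` (?Q \<times> follow_n X w n)"
  proof
    fix u assume "u \<in> language_n X n"
    then obtain x i where x: "x \<in> X" and u: "u = window x i n"
      by (auto simp: language_n_def elim: languageE)
    \<comment> \<open>The length is \<open>R + 1\<close> because \<open>R\<close> may be 0, and the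
      language has no empty word.\<close>
    have "sublist w (window x i (R + 1))"
      using x by (intro rec window_in_language) auto
    then obtain a b where ab: "window x i (R + 1) = a @ w @ b"
      by (auto simp: sublist_def)
    let ?l = "length a + length w"
    have l: "?l \<le> R + 1" using arg_cong[OF ab, of length] by simp
    have "window x i ?l = a @ w"
      using arg_cong[OF ab, of "take ?l"] l by (simp add: take_window del: append_assoc add: append_assoc[symmetric])
    then have w: "w = window x (i + int (length a)) (length w)" and a: "a = window x i (length a)"
      by (auto simp: window_add)
    let ?v = "window x (i + int (length a) + int (length w)) n"
    have v: "?v \<in> follow_n X w n"
      using window_in_follow_n[OF x w assms(2)] .
    have "u = take n (window x i (?l + n))"
      by (simp add: u take_window)
    also have "window x i (?l + n) = (a @ w) @ ?v"
      using \<open>window x i ?l = a @ w\<close> window_add[of x i ?l n] by (simp add: add.assoc)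
    finally show "u \<in> (\<lambda>(q, v). take n (q @ v)) ` (?Q \<times> follow_n X w n)"
      using v l by (intro image_eqI[of _ _ "(a @ w, ?v)"]) auto
  qed
  then have "card (language_n X n) \<le> card (?Q \<times> follow_n X w n)"
    using fin by (intro surj_card_le) auto
  then show ?thesis by (simp add: card_cartesian_product)
qed

text \<open>The counting argument, separated from substitutions: these enter only through linear
  complexity and uniform recurrence.\<close>

theorem lambda_synchronizing_of_linear_complexity:
  fixes X :: "(int \<Rightarrow> 'a::finite) set"
  assumes lin: "\<And>n. 0 < n \<Longrightarrow> card (language_n X n) \<le> C * n"
    and rec: "\<And>w. w \<in> language X \<Longrightarrow> \<exists>R. \<forall>u\<in>language X. R \<le> length u \<longrightarrow> sublist w u"
  shows "lambda_synchronizing X"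
  unfolding lambda_synchronizing_def
proof (intro ballI allI)
  fix w and k :: nat
  assume w: "w \<in> language X"
  show "\<exists>v. v \<in> synchronizing_words X k \<inter> Gamma_plus X w"
  proof (rule ccontr)
    assume none: "\<not> ?thesis"
    \<comment> \<open>For \<open>k = 0\<close> the set \<open>Gamma_minus X k v\<close> is empty, so
      any word that follows \<open>w\<close> is synchronizing.\<close>
    have k: "0 < k"
    proof (rule ccontr)
      assume "\<not> 0 < k"
      obtain v where "v \<in> follow_n X w 1"
        using follow_n_nonempty[OF w, of 1] by auto
      moreover have "language_n X 0 = {}"
        by (auto simp: language_n_def language_def)
      ultimately have "v \<in> synchronizing_words X k \<inter> Gamma_plus X w"
        using \<open>\<not> 0 < k\<close>
        by (auto simp: synchronizing_words_def Gamma_minus_def follow_n_def Gamma_plus_def)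
      then show False using none by blast
    qed
    let ?p = "\<lambda>n. card (language_n X n)" and ?g = "\<lambda>n. card (follow_n X w n)"
    have step: "?p n + ?g n \<le> ?p (n + k)" for n
    proof (rule complexity_increment[OF follow_n_subset _ k])
      show "follow_n X w n \<inter> synchronizing_words X k = {}"
        using none by (auto simp: follow_n_def)
    qed
    have g_bound: "?g n \<le> C * k" if n: "0 < n" for n
    proof (rule ccontr)
      assume "\<not> ?g n \<le> C * k"
      then have "?p m + (C * k + 1) \<le> ?p (m + k)" if "n \<le> m" for m
        using card_follow_n_mono[OF n that, of X w] step[of m] by linarith
      \<comment> \<open>From \<open>n\<close> on the complexity grows with slope above
        \<open>C\<close>. After \<open>C * n + 1\<close> steps of length \<open>k\<close> the gain
        of one per step outweighs the head start \<open>C * n\<close> by exactly 1.\<close>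
      from linear_growth_of_increments[of n ?p, OF this]
      have "(C * n + 1) * (C * k + 1) \<le> ?p (n + (C * n + 1) * k)" by blast
      also have "\<dots> \<le> C * (n + (C * n + 1) * k)"
        using n by (intro lin) simp
      finally show False by (simp add: algebra_simps)
    qed
    obtain R where R: "\<And>u. u \<in> language X \<Longrightarrow> R \<le> length u \<Longrightarrow> sublist w u"
      using rec[OF w] by auto
    define D where "D = card {q :: 'a list. length q \<le> R + 1} * (C * k)"
    have p_bound: "?p n \<le> D" if "0 < n" for n
      unfolding D_def
      by (rule le_trans[OF complexity_le_follow[OF R that] mult_le_mono2[OF g_bound[OF that]]])
    have "?p n + 1 \<le> ?p (n + k)" if "1 \<le> n" for n
    proof -
      have "0 < ?g n" using follow_n_nonempty[OF w] that by (simp add: card_gt_0_iff)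
      then show ?thesis using step[of n] by linarith
    qed
    \<comment> \<open>At least one new word per step: \<open>D + 1\<close> steps exceed the bound
      \<open>D\<close>.\<close>
    from linear_growth_of_increments[of 1 ?p, OF this]
    have "(D + 1) * 1 \<le> ?p (1 + (D + 1) * k)" by blast
    then show False using p_bound[of "1 + (D + 1) * k"] by simp
  qed
qed

section \<open>Concatenations of blocks\<close>

text \<open>A word no longer than any block cannot reach past the block after the one where it
  begins: if it straddles the end of the first block, its remainder is a prefix of the
  second.\<close>

lemma sublist_concat_two_blocks:
  assumes "sublist u (concat (map f xs))" "xs \<noteq> []" "\<And>a. length u \<le> length (f a)"
  shows "\<exists>a b. sublist u (f a @ f b)"
  using assms(1,2)
proof (induction xs)
  case (Cons x xs)
  show ?case
  proof (cases xs)
    case Nil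
    then show ?thesis using Cons.prems by (auto simp: sublist_append)
  next
    case (Cons y ys)
    from Cons.prems(1) consider "sublist u (f x)" | "sublist u (concat (map f xs))"
      | u1 u2 where "u = u1 @ u2" "suffix u1 (f x)" "prefix u2 (concat (map f xs))"
      by (auto simp: sublist_append)
    then show ?thesis
    proof cases
      case 1
      then show ?thesis by (auto simp: sublist_append)
    next
      case 2
      then show ?thesis using Cons.IH Cons by simp
    next
      case 3
      have "prefix u2 (f y)"
        using 3 assms(3)[of y] Cons
        by (intro prefix_length_prefix[of u2 "concat (map f xs)" "f y"]) auto
      then show ?thesis using 3 by (metis sublist_append)
    qed
  qed
qed simp

text \<open>At most \<open>M\<close> letters are spent on the partial block where \<open>u\<close>
  begins; the remaining \<open>M\<close> or more cover the next block completely.\<close>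

lemma block_sublist_of_long_sublist:
  assumes "sublist u (concat (map f xs))" "\<And>a. length (f a) \<le> M" "0 < M" "2 * M \<le> length u"
  shows "\<exists>a. sublist (f a) u"
  using assms(1)
proof (induction xs)
  case Nil
  then show ?case using assms(3,4) by simp
next
  case (Cons x xs)
  from Cons.prems consider "sublist u (f x)" | "sublist u (concat (map f xs))"
    | u1 u2 where "u = u1 @ u2" "suffix u1 (f x)" "prefix u2 (concat (map f xs))"
    by (auto simp: sublist_append)
  then show ?case
  proof cases
    case 1
    then show ?thesis
      using sublist_length_le[OF 1] assms(2)[of x] assms(3,4) by linarith
  next
    case 2
    then show ?thesis using Cons.IH by simp
  next
    case 3
    have "length u1 \<le> M" using suffix_length_le[OF 3(2)] assms(2)[of x] by linarith
    then have M: "M \<le> length u2" using 3(1) assms(4) by simp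
    then obtain y ys where "xs = y # ys"
      using 3(3) assms(3) by (cases xs) auto
    then have "prefix (f y) u2"
      using 3(3) M assms(2)[of y]
      by (intro prefix_length_prefix[of "f y" "concat (map f xs)" u2]) auto
    then show ?thesis using 3(1)
      by (metis prefix_imp_sublist sublist_append)
  qed
qed

text \<open>A word of length \<open>n\<close> is determined by the two blocks and its offset in
  them, which is at most \<open>2 * M\<close>.\<close>

lemma card_sublists_two_blocks:
  fixes f :: "'a::finite \<Rightarrow> 'a list"
  assumes "\<And>a. length (f a) \<le> M" "\<And>u. u \<in> U \<Longrightarrow> length u = n \<and> (\<exists>a b. sublist u (f a @ f b))"
  shows "card U \<le> (card (UNIV :: 'a set))\<^sup>2 * (2 * M + 1)"
proof -
  let ?I = "(UNIV :: 'a set) \<times> (UNIV :: 'a set) \<times> {..2 * M}"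
  have "U \<subseteq> (\<lambda>(a, b, i). take n (drop i (f a @ f b))) ` ?I"
  proof
    fix u assume "u \<in> U"
    with assms(2) obtain a b ps ss where u: "length u = n" "f a @ f b = ps @ u @ ss"
      by (force simp: sublist_def)
    have "length ps \<le> length (f a @ f b)" by (simp only: u(2) length_append le_add1)
    also have "\<dots> \<le> 2 * M" using assms(1)[of a] assms(1)[of b] by simp
    finally have "(a, b, length ps) \<in> ?I" by simp
    moreover have "u = take n (drop (length ps) (f a @ f b))"
      by (simp add: u(1)[symmetric] u(2))
    ultimately show "u \<in> (\<lambda>(a, b, i). take n (drop i (f a @ f b))) ` ?I"
      by (intro image_eqI[of _ _ "(a, b, length ps)"]) auto
  qed
  then have "card U \<le> card ?I" by (intro surj_card_le) auto
  then show ?thesis by (simp add: card_cartesian_product power2_eq_square mult.assoc del: mult_Suc_right)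
qed

section \<open>Iterates of a primitive substitution\<close>

abbreviation iterate :: "('a \<Rightarrow> 'a list) \<Rightarrow> nat \<Rightarrow> 'a \<Rightarrow> 'a list" where
  "iterate \<tau> n a \<equiv> (subst_word \<tau> ^^ n) [a]"

lemma subst_word_concat_map:
  "subst_word \<tau> (concat (map f xs)) = concat (map (\<lambda>x. subst_word \<tau> (f x)) xs)"
  by (induction xs) (auto simp: subst_word_def)

lemma subst_word_funpow: "(subst_word \<tau> ^^ n) xs = concat (map (iterate \<tau> n) xs)"
  by (induction n) (simp_all add: subst_word_concat_map)

text \<open>The block decomposition used below: the blocks have level \<open>m\<close> and are
  indexed by the letters of the iterate of level \<open>n\<close>.\<close>

lemma iterate_add: "iterate \<tau> (m + n) a = concat (map (iterate \<tau> m) (iterate \<tau> n a))"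
  using subst_word_funpow[where n = m and xs = "iterate \<tau> n a"] by (simp add: funpow_add)

lemma iterate_nonempty:
  assumes "is_substitution \<tau>"
  shows "iterate \<tau> n a \<noteq> []"
proof (induction n)
  case (Suc n)
  then show ?case using assms
    by (cases "iterate \<tau> n a") (auto simp: subst_word_def is_substitution_def)
qed simp

lemma sublist_concat_map: "a \<in> set xs \<Longrightarrow> sublist (f a) (concat (map f xs))"
  by (induction xs) (auto simp: sublist_append)

section \<open>Lengths of iterates\<close>

lemma sum_set_le_sum_list: "sum f (set xs) \<le> sum_list (map f xs)" for f :: "'a \<Rightarrow> nat"
  by (induction xs) (auto simp: sum.insert_if)

text \<open>The sum of the entries of the \<open>n\<close>-th power of the incidence matrix. It
  serves as a common scale for all blocks of level \<open>n\<close>.\<close>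

definition total_length :: "('a::finite \<Rightarrow> 'a list) \<Rightarrow> nat \<Rightarrow> nat" where
  "total_length \<tau> n = (\<Sum>a\<in>UNIV. length (iterate \<tau> n a))"

lemma length_iterate_le: "length (iterate \<tau> n a) \<le> total_length \<tau> n"
  unfolding total_length_def by (rule member_le_sum) auto

lemma total_length_add_le: "total_length \<tau> (m + n) \<le> total_length \<tau> m * total_length \<tau> n"
proof -
  have "length (iterate \<tau> (m + n) a) \<le> total_length \<tau> m * length (iterate \<tau> n a)" for a
  proof -
    have "sum_list (map (\<lambda>b. length (iterate \<tau> m b)) xs) \<le> total_length \<tau> m * length xs" for xs
      by (induction xs) (simp_all add: add_le_mono length_iterate_le)
    then show ?thesis by (simp add: iterate_add length_concat o_def)
  qed
  then show ?thesis
    unfolding total_length_def[of \<tau> "m + n"] total_length_def[of \<tau> n] sum_distrib_left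
    by (intro sum_mono)
qed

text \<open>All letters occur in \<open>iterate \<tau> n a\<close>, so the blocks of level
  \<open>m\<close> of all letters lie side by side in the longer iterate. This bounds block lengths
  from below.\<close>

lemma total_length_le_length_iterate:
  assumes "set (iterate \<tau> n a) = UNIV"
  shows "total_length \<tau> m \<le> length (iterate \<tau> (m + n) a)"
  using sum_set_le_sum_list[of "\<lambda>b. length (iterate \<tau> m b)" "iterate \<tau> n a"] assms
  by (simp add: total_length_def iterate_add length_concat o_def)

section \<open>Letters and words in high iterates\<close>

lemma iterate_full_mono:
  assumes "is_substitution \<tau>" "\<And>a. set (iterate \<tau> n a) = UNIV"
  shows "set (iterate \<tau> (n + m) a) = UNIV"
proof -
  obtain b where "b \<in> set (iterate \<tau> m a)"
    using iterate_nonempty[OF assms(1), of m a] by (cases "iterate \<tau> m a") auto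
  then have "set (iterate \<tau> n b) \<subseteq> set (iterate \<tau> (n + m) a)"
    by (auto simp: iterate_add)
  then show ?thesis using assms(2) by auto
qed

lemma language_substitution_systemD:
  assumes "w \<in> language (substitution_system \<tau>)"
  shows "\<exists>n a. sublist w (iterate \<tau> n a)"
  using assms by (auto simp: language_def substitution_system_def)

text \<open>The letter \<open>a\<close> occurs in every iterate of level at least \<open>N\<close>,
  so its block of level \<open>n\<close> occurs in every iterate of level at least
  \<open>n + N\<close>. The starting letter thus becomes irrelevant.\<close>

lemma eventually_sublist_iterate:
  assumes "is_substitution \<tau>" "\<And>a. set (iterate \<tau> N a) = UNIV" "sublist w (iterate \<tau> n a)"
    and "n + N \<le> m"
  shows "sublist w (iterate \<tau> m b)"
proof -
  obtain d where m: "m = n + (N + d)" using assms(4) by (metis add.assoc le_iff_add)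
  have "a \<in> set (iterate \<tau> (N + d) b)"
    using iterate_full_mono[OF assms(1,2)] by auto
  then have "sublist (iterate \<tau> n a) (iterate \<tau> m b)"
    unfolding m iterate_add[where m = n] by (rule sublist_concat_map)
  then show ?thesis using assms(3) sublist_order.order_trans by blast
qed

text \<open>The level \<open>m\<close> is free: a word is first moved to the higher level
  \<open>m + (n + N)\<close>, which is then cut into blocks of level \<open>m\<close>.\<close>

lemma language_sublist_blocks:
  assumes "is_substitution \<tau>" "\<And>a. set (iterate \<tau> N a) = UNIV"
    and "u \<in> language (substitution_system \<tau>)"
  obtains xs where "xs \<noteq> []" "sublist u (concat (map (iterate \<tau> m) xs))"
proof -
  obtain n a where "sublist u (iterate \<tau> n a)"
    using language_substitution_systemD[OF assms(3)] by blast
  then have "sublist u (iterate \<tau> (m + (n + N)) a)"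
    by (rule eventually_sublist_iterate[OF assms(1,2)]) simp
  then show thesis
    using that[of "iterate \<tau> (n + N) a"] iterate_nonempty[OF assms(1)] by (simp add: iterate_add)
qed

text \<open>At a suitable level every block contains \<open>w\<close>, and a word twice as long as
  the longest block contains a whole block.\<close>

lemma substitution_system_uniformly_recurrent:
  fixes \<tau> :: "'a::finite \<Rightarrow> 'a list"
  assumes "is_substitution \<tau>" "\<And>a. set (iterate \<tau> N a) = UNIV"
    and "w \<in> language (substitution_system \<tau>)"
  shows "\<exists>R. \<forall>u\<in>language (substitution_system \<tau>). R \<le> length u \<longrightarrow> sublist w u"
proof -
  obtain n a where n: "sublist w (iterate \<tau> n a)"
    using language_substitution_systemD[OF assms(3)] by blast
  define m where "m = n + N"
  have w: "sublist w (iterate \<tau> m b)" for b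
    using eventually_sublist_iterate[OF assms(1,2) n] by (simp add: m_def)
  have pos: "0 < total_length \<tau> m"
    using length_iterate_le[where \<tau> = \<tau> and n = m and a = a] iterate_nonempty[OF assms(1), of m a]
    by (metis length_greater_0_conv less_le_trans)
  have "sublist w u"
    if u: "u \<in> language (substitution_system \<tau>)" and len: "2 * total_length \<tau> m \<le> length u" for u
  proof -
    obtain xs where "sublist u (concat (map (iterate \<tau> m) xs))"
      using language_sublist_blocks[OF assms(1,2) u] .
    from block_sublist_of_long_sublist[OF this length_iterate_le pos len]
    obtain b where "sublist (iterate \<tau> m b) u" by blast
    then show ?thesis using w sublist_order.order_trans by blast
  qed
  then show ?thesis by blast
qed

lemma substitution_system_linear_complexity:
  fixes \<tau> :: "'a::finite \<Rightarrow> 'a list"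
  assumes "is_substitution \<tau>" "\<And>a. set (iterate \<tau> N a) = UNIV"
  shows "\<exists>C. \<forall>n>0. card (language_n (substitution_system \<tau>) n) \<le> C * n"
proof -
  let ?X = "substitution_system \<tau>"
  \<comment> \<open>The first summand covers the least level 0, the second the passage from level
    \<open>q - 1\<close> to \<open>q\<close>, and the last factor the passage to
    \<open>q + N\<close>.\<close>
  define K where "K = (total_length \<tau> 0 + total_length \<tau> 1) * total_length \<tau> N"
  define C where "C = (card (UNIV :: 'a set))\<^sup>2 * (2 * K + 1)"
  have "card (language_n ?X n) \<le> C * n" if n: "0 < n" for n
  \<comment> \<open>A word of length \<open>n\<close> guarantees a level whose total length reaches
    \<open>n\<close>. Otherwise the lengths may stay bounded, as for the identity substitution on
    one letter.\<close>
  proof (cases "language_n ?X n = {}")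
    case False
    then obtain u m a where u: "length u = n" "sublist u (iterate \<tau> m a)"
      using language_substitution_systemD by (fastforce simp: language_n_def)
    then have ex: "n \<le> total_length \<tau> m"
      using sublist_length_le[OF u(2)] length_iterate_le[where \<tau> = \<tau> and n = m and a = a] by simp
    \<comment> \<open>By minimality of \<open>q\<close>, the total length at level \<open>q\<close>
      is at least \<open>n\<close> and at most a fixed multiple of \<open>n\<close>. Raising the
      level by \<open>N\<close> gives every single block a length between \<open>n\<close> and
      \<open>K * n\<close>.\<close>
    define q where "q = (LEAST q. n \<le> total_length \<tau> q)"
    have q: "n \<le> total_length \<tau> q" unfolding q_def using ex by (rule LeastI)
    have "total_length \<tau> q \<le> (total_length \<tau> 0 + total_length \<tau> 1) * n"
    proof (cases q)
      case 0
      then show ?thesis using n by (cases n) auto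
    next
      case (Suc r)
      then have "total_length \<tau> r < n"
        using not_less_Least[of r "\<lambda>q. n \<le> total_length \<tau> q"] by (simp add: q_def)
      then have "total_length \<tau> q \<le> total_length \<tau> 1 * n"
        using total_length_add_le[of \<tau> 1 r] Suc
        by (metis le_trans less_imp_le mult_le_mono2 plus_1_eq_Suc)
      then show ?thesis by (simp add: algebra_simps)
    qed
    then have "total_length \<tau> q * total_length \<tau> N \<le> K * n"
      unfolding K_def using mult_le_mono1 by (fastforce simp: mult.commute mult.left_commute)
    then have upper: "length (iterate \<tau> (q + N) a) \<le> K * n" for a
      using length_iterate_le[where \<tau> = \<tau> and n = "q + N" and a = a] total_length_add_le[of \<tau> q N] by linarith
    have lower: "n \<le> length (iterate \<tau> (q + N) a)" for a
      using q total_length_le_length_iterate[OF assms(2)] le_trans by blast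
    have "length u = n \<and> (\<exists>a b. sublist u (iterate \<tau> (q + N) a @ iterate \<tau> (q + N) b))"
      if u: "u \<in> language_n ?X n" for u
    proof -
      have u': "u \<in> language ?X" "length u = n" using u by (auto simp: language_n_def)
      obtain xs where "xs \<noteq> []" "sublist u (concat (map (iterate \<tau> (q + N)) xs))"
        using language_sublist_blocks[OF assms u'(1)] .
      then show ?thesis
        using sublist_concat_two_blocks[of u "iterate \<tau> (q + N)" xs] lower u'(2) by simp
    qed
    from card_sublists_two_blocks[OF upper this]
    have "card (language_n ?X n) \<le> (card (UNIV :: 'a set))\<^sup>2 * (2 * (K * n) + 1)" .
    also have "\<dots> \<le> (card (UNIV :: 'a set))\<^sup>2 * ((2 * K + 1) * n)"
      using n by (intro mult_le_mono2) (simp add: algebra_simps)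
    finally show ?thesis by (simp only: C_def mult.assoc)
  qed simp
  then show ?thesis by blast
qed

theorem theorem4p1:
  fixes \<tau> :: "'a::finite \<Rightarrow> 'a list"
  assumes "is_substitution \<tau>"
    and "primitive_subst \<tau>"
  shows "lambda_synchronizing (substitution_system \<tau>)"
proof -
  obtain N where N: "\<And>a. set (iterate \<tau> N a) = UNIV"
    using assms(2) by (auto simp: primitive_subst_def)
  obtain C where "\<And>n. 0 < n \<Longrightarrow> card (language_n (substitution_system \<tau>) n) \<le> C * n"
    using substitution_system_linear_complexity[OF assms(1) N] by blast
  then show ?thesis
    using substitution_system_uniformly_recurrent[OF assms(1) N]
    by (rule lambda_synchronizing_of_linear_complexity)
qed

end
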